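(* Let $f:\mathbb{R}\to\mathbb{C}$ be twice differentiable with $f,f',f''$ continuous on $\mathbb{R}$, and suppose that $f$ and $f'$ are of exponential order $a$. Then for every $s=x+iy$ with $x>a$ and $y\in\mathbb{R}$, $$\mathcal{SL}(f'')(s)=s^2\,\mathcal{L}(f(t))(s)+\overline{s}^{\,2}\,\mathcal{L}(f(-t))(\overline{s})-f(0)(s+\overline{s}).$$
   Context: A function $f:\mathbb{R}\to\mathbb{C}$ is of exponential order $a$ (where $a>0$) if there is a constant $M>0$ such that $|f(t)|\le Me^{a|t|}$ for all $t\in\mathbb{R}$. The Laplace transform of a function $h$ on $[0,\infty)$ is $\mathcal{L}(h(t))(s)=\int_0^\infty e^{-st}h(t)\,dt$; thus $\mathcal{L}(f(-t))(\overline{s})=\int_0^\infty e^{-\overline{s}t}f(-t)\,dt$. For $s=x+iy$, the symmetric Laplace transform of $h:\mathbb{R}\to\mathbb{C}$ (with equal parameters $x_1=x_2=x$) is $$\mathcal{SL}(h)(s)=\int_0^\infty h(t)e^{-st}\,dt+\int_{-\infty}^0 h(t)e^{\overline{s}t}\,dt=\mathcal{L}(h(t))(s)+\mathcal{L}(h(-t))(\overline{s}).$$ Integrals over unbounded intervals are improper integrals, i.e. $\int_0^\infty=\lim_{R\to\infty}\int_0^R$ and $\int_{-\infty}^0=\lim_{R\to\infty}\int_{-R}^0$. *)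

theory Defs
  imports "HOL-Analysis.Analysis"
begin

definition exponential_order :: "real \<Rightarrow> (real \<Rightarrow> complex) \<Rightarrow> bool" where
  "exponential_order a f \<longleftrightarrow> (\<exists>M>0. \<forall>t. norm (f t) \<le> M * exp (a * \<bar>t\<bar>))"

text \<open>
  Integrals over half-lines are improper integrals, possibly only conditionally convergent.
  As \<open>Lim\<close> and \<open>integral\<close> are total functions, the value of a divergent improper
  integral is arbitrary, so convergence is recorded by separate predicates.
\<close>

definition improper_converges_right :: "(real \<Rightarrow> complex) \<Rightarrow> bool" where
  "improper_converges_right g \<longleftrightarrow>
     (\<forall>R\<ge>0. g integrable_on {0..R}) \<and>
     (\<exists>l. ((\<lambda>R. integral {0..R} g) \<longlongrightarrow> l) at_top)"

definition improper_converges_left :: "(real \<Rightarrow> complex) \<Rightarrow> bool" where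
  "improper_converges_left g \<longleftrightarrow>
     (\<forall>R\<ge>0. g integrable_on {-R..0}) \<and>
     (\<exists>l. ((\<lambda>R. integral {-R..0} g) \<longlongrightarrow> l) at_top)"

definition improper_integral_right :: "(real \<Rightarrow> complex) \<Rightarrow> complex" where
  "improper_integral_right g = Lim at_top (\<lambda>R::real. integral {0..R} g)"

definition improper_integral_left :: "(real \<Rightarrow> complex) \<Rightarrow> complex" where
  "improper_integral_left g = Lim at_top (\<lambda>R::real. integral {-R..0} g)"

definition laplace_converges :: "(real \<Rightarrow> complex) \<Rightarrow> complex \<Rightarrow> bool" where
  "laplace_converges h s \<longleftrightarrow>
     improper_converges_right (\<lambda>t. exp (- s * of_real t) * h t)"

definition laplace :: "(real \<Rightarrow> complex) \<Rightarrow> complex \<Rightarrow> complex" where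
  "laplace h s = improper_integral_right (\<lambda>t. exp (- s * of_real t) * h t)"

definition sym_laplace_converges :: "(real \<Rightarrow> complex) \<Rightarrow> complex \<Rightarrow> bool" where
  "sym_laplace_converges h s \<longleftrightarrow>
     improper_converges_right (\<lambda>t. h t * exp (- s * of_real t)) \<and>
     improper_converges_left (\<lambda>t. h t * exp (cnj s * of_real t))"

definition sym_laplace :: "(real \<Rightarrow> complex) \<Rightarrow> complex \<Rightarrow> complex" where
  "sym_laplace h s =
     improper_integral_right (\<lambda>t. h t * exp (- s * of_real t)) +
     improper_integral_left (\<lambda>t. h t * exp (cnj s * of_real t))"

end

theory Submission
  imports Defs
begin

text \<open>
  The function \<open>(f' t + s * f t) * exp (- s * t)\<close> is an antiderivative of
  \<open>(f'' t - s\<^sup>2 * f t) * exp (- s * t)\<close> and vanishes at infinity, which gives the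
  one-sided identity \<open>L f'' = s\<^sup>2 L f - s f(0) - f'(0)\<close>. Applied to \<open>f\<close> at \<open>s\<close> and to
  the reflection of \<open>f\<close> at \<open>cnj s\<close>, it yields the symmetric formula: the terms in
  \<open>f'(0)\<close> cancel because reflection changes the sign of the first derivative.
\<close>

lemma improper_integral_rightI:
  assumes "\<And>R. R \<ge> 0 \<Longrightarrow> g integrable_on {0..R}"
    and "((\<lambda>R. integral {0..R} g) \<longlongrightarrow> l) at_top"
  shows "improper_converges_right g" and "improper_integral_right g = l"
  using assms unfolding improper_converges_right_def improper_integral_right_def
  by (auto intro: tendsto_Lim)

lemma improper_integral_right_tendsto:
  assumes "improper_converges_right g"
  shows "((\<lambda>R. integral {0..R} g) \<longlongrightarrow> improper_integral_right g) at_top"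
  using assms unfolding improper_converges_right_def
  by (metis improper_integral_rightI(2))

text \<open>The substitution t -> -t carries \<open>{-R..0}\<close> to \<open>{0..R}\<close>, so all
  estimates can be made on the right half-line alone.\<close>

lemma improper_converges_left_reflect:
  "improper_converges_left g \<longleftrightarrow> improper_converges_right (\<lambda>t. g (- t))"
  unfolding improper_converges_left_def improper_converges_right_def
  using Henstock_Kurzweil_Integration.integrable_reflect_real[where f = "\<lambda>t. g (- t)" and a = 0]
    Henstock_Kurzweil_Integration.integral_reflect_real[where f = "\<lambda>t. g (- t)" and a = 0]
  by simp

lemma improper_integral_left_reflect:
  "improper_integral_left g = improper_integral_right (\<lambda>t. g (- t))"
proof -
  have "integral {-R..0} g = integral {0..R} (\<lambda>t. g (- t))" for R
    using Henstock_Kurzweil_Integration.integral_reflect_real[where f = "\<lambda>t. g (- t)" and a = 0] by simp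
  then show ?thesis
    by (simp add: improper_integral_left_def improper_integral_right_def)
qed

lemma exponential_order_reflect:
  "exponential_order a f \<Longrightarrow> exponential_order a (\<lambda>t. f (- t))"
  unfolding exponential_order_def by (metis abs_minus)

lemma exponential_order_uminus:
  "exponential_order a f \<Longrightarrow> exponential_order a (\<lambda>t. - f t)"
  unfolding exponential_order_def by simp

text \<open>The kernel has norm \<open>exp (- Re s * t)\<close>, which absorbs the growth
  \<open>exp (a * t)\<close>. For \<open>Re s > a\<close> the bound decays, and it then serves both
  as a null majorant and as an integrable one.\<close>

lemma exponential_order_damped_bound:
  assumes "exponential_order a f"
  obtains M where "\<And>t. t \<ge> 0 \<Longrightarrow> norm (exp (- s * of_real t) * f t) \<le> M * exp (- (Re s - a) * t)"
proof -
  obtain M where M: "\<And>t. norm (f t) \<le> M * exp (a * \<bar>t\<bar>)"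
    using assms unfolding exponential_order_def by blast
  have "norm (exp (- s * of_real t) * f t) \<le> M * exp (- (Re s - a) * t)" if "t \<ge> 0" for t
  proof -
    have "norm (exp (- s * of_real t) * f t) = exp (- Re s * t) * norm (f t)"
      by (simp add: norm_mult)
    also have "\<dots> \<le> exp (- Re s * t) * (M * exp (a * t))"
      using M[of t] that by (intro mult_left_mono) auto
    also have "\<dots> = M * exp (- (Re s - a) * t)"
      by (simp add: algebra_simps flip: exp_add)
    finally show ?thesis .
  qed
  with that show ?thesis by blast
qed

text \<open>This removes the boundary terms at infinity when integrating by parts.\<close>

lemma exponential_order_damped_tendsto_0:
  assumes "exponential_order a f" and "Re s > a"
  shows "((\<lambda>t. exp (- s * of_real t) * f t) \<longlongrightarrow> 0) at_top"
proof -
  obtain M where M: "\<And>t. t \<ge> 0 \<Longrightarrow>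
      norm (exp (- s * of_real t) * f t) \<le> M * exp (- (Re s - a) * t)"
    using exponential_order_damped_bound[OF assms(1)] by blast
  have "filterlim (\<lambda>t. - (Re s - a) * t) at_bot at_top"
    using assms(2) by (intro filterlim_tendsto_neg_mult_at_bot[OF tendsto_const] filterlim_ident) auto
  then have "((\<lambda>t. M * exp (- (Re s - a) * t)) \<longlongrightarrow> M * 0) at_top"
    by (intro tendsto_mult tendsto_const filterlim_compose[OF exp_at_bot])
  then have "((\<lambda>t. M * exp (- (Re s - a) * t)) \<longlongrightarrow> 0) at_top"
    by simp
  then show ?thesis
    by (rule Lim_null_comparison[rotated])
       (use M in \<open>auto intro: eventually_mono[OF eventually_ge_at_top[of 0]]\<close>)
qed

text \<open>Domination by a decaying exponential makes the integrand Lebesgue integrable on the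
  whole half-line, and the truncated integrals converge to that Lebesgue integral.\<close>

lemma laplace_converges_exponential_order:
  assumes cont: "continuous_on UNIV f" and ord: "exponential_order a f" and "Re s > a"
  shows "laplace_converges f s"
proof -
  define g where "g = (\<lambda>t. exp (- s * of_real t) * f t)"
  obtain M where M: "\<And>t. t \<ge> 0 \<Longrightarrow> norm (g t) \<le> M * exp (- (Re s - a) * t)"
    using exponential_order_damped_bound[OF ord] unfolding g_def by blast
  have cont_g: "continuous_on A g" for A
    unfolding g_def by (intro continuous_intros continuous_on_subset[OF cont]) auto
  have "g absolutely_integrable_on {0..}"
  proof (rule measurable_bounded_by_integrable_imp_absolutely_integrable)
    show "g \<in> borel_measurable (lebesgue_on {0..})"
      using cont_g by (rule continuous_imp_measurable_on_sets_lebesgue) auto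
    show "(\<lambda>t. M * exp (- (Re s - a) * t)) integrable_on {0..}"
      using assms(3) by (intro integrable_on_mult_right integrable_on_exp_minus_to_infinity) auto
    show "norm (g t) \<le> M * exp (- (Re s - a) * t)" if "t \<in> {0..}" for t
      using M that by simp
  qed simp
  then have int: "set_integrable lebesgue {0..} g" .
  have "((\<lambda>R. set_lebesgue_integral lebesgue {0..R} g) \<longlongrightarrow>
      set_lebesgue_integral lebesgue {0..} g) at_top"
    using int by (intro tendsto_set_lebesgue_integral_at_top) auto
  moreover have "set_lebesgue_integral lebesgue {0..R} g = integral {0..R} g" for R
    by (intro set_lebesgue_integral_eq_integral set_integrable_subset[OF int]) auto
  ultimately have "((\<lambda>R. integral {0..R} g) \<longlongrightarrow> set_lebesgue_integral lebesgue {0..} g) at_top"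
    by simp
  then show ?thesis
    unfolding laplace_converges_def g_def[symmetric]
    by (intro improper_integral_rightI(1) integrable_continuous_interval cont_g)
qed

text \<open>No growth bound on \<open>f''\<close> is at hand, so its transform is not treated by
  domination. Its truncated integrals are computed exactly, and their convergence is inherited from
  \<open>F\<close> and the transform of \<open>f\<close>.\<close>

lemma laplace_second_derivative:
  assumes f': "\<And>t. (f has_vector_derivative f' t) (at t)"
    and f'': "\<And>t. (f' has_vector_derivative f'' t) (at t)"
    and ord: "exponential_order a f" "exponential_order a f'"
    and s: "Re s > a"
  shows "laplace_converges f s" and "laplace_converges f'' s"
    and "laplace f'' s = s\<^sup>2 * laplace f s - s * f 0 - f' 0"
proof -
  let ?e = "\<lambda>t. exp (- s * of_real t)"
  \<comment> \<open>The antiderivative is split into two damped products, so that the product rule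
    and the decay lemma apply to each summand.\<close>
  define F where "F = (\<lambda>t. ?e t * f' t + s * (?e t * f t))"
  have "continuous_on UNIV f"
    using f' by (meson continuous_at_imp_continuous_on has_vector_derivative_continuous)
  then show conv: "laplace_converges f s"
    using ord(1) s by (rule laplace_converges_exponential_order)
  \<comment> \<open>An arbitrary set \<open>A\<close> is allowed because the fundamental theorem of
    calculus asks for derivatives within \<open>{0..R}\<close>.\<close>
  have e: "(?e has_vector_derivative - s * ?e t) (at t within A)" for t A
    by (auto intro!: derivative_eq_intros has_vector_derivative_real_field
        simp: algebra_simps)
  have F: "(F has_vector_derivative ?e t * f'' t - s\<^sup>2 * (?e t * f t)) (at t within A)" for t A
  proof -
    \<comment> \<open>The two terms in \<open>?e t * f' t\<close> cancel; this is what the factor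
      \<open>s\<close> in \<open>F\<close> is for.\<close>
    have "(F has_vector_derivative
        (?e t * f'' t + - s * ?e t * f' t) + s * (?e t * f' t + - s * ?e t * f t)) (at t within A)"
      unfolding F_def
      by (intro has_vector_derivative_add has_vector_derivative_mult e
          bounded_linear.has_vector_derivative[OF bounded_linear_mult_right]
          has_vector_derivative_at_within[OF f'] has_vector_derivative_at_within[OF f''])
    then show ?thesis
      by (simp add: algebra_simps power2_eq_square)
  qed
  have ftc: "((\<lambda>t. ?e t * f'' t - s\<^sup>2 * (?e t * f t)) has_integral F R - F 0) {0..R}"
    if "R \<ge> 0" for R
    using that F by (intro fundamental_theorem_of_calculus)
  have int_f: "(\<lambda>t. ?e t * f t) integrable_on {0..R}" if "R \<ge> 0" for R
    using conv that unfolding laplace_converges_def improper_converges_right_def by blast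
  \<comment> \<open>Adding the integrable term in \<open>f\<close> back isolates \<open>f''\<close>
    and gives its integrability on \<open>{0..R}\<close> as well.\<close>
  have int: "((\<lambda>t. ?e t * f'' t) has_integral
      F R - F 0 + s\<^sup>2 * integral {0..R} (\<lambda>t. ?e t * f t)) {0..R}" if "R \<ge> 0" for R
    using has_integral_add[OF ftc[OF that]
        has_integral_mult_right[OF integrable_integral[OF int_f[OF that]], of "s\<^sup>2"]]
    by simp
  \<comment> \<open>The limit keeps the unsimplified shape that \<open>tendsto_intros\<close>
    produces.\<close>
  have "(F \<longlongrightarrow> 0 + s * 0) at_top"
    unfolding F_def by (intro tendsto_intros exponential_order_damped_tendsto_0[OF _ s] ord)
  then have "((\<lambda>R. F R - F 0 + s\<^sup>2 * integral {0..R} (\<lambda>t. ?e t * f t))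
      \<longlongrightarrow> 0 + s * 0 - F 0 + s\<^sup>2 * laplace f s) at_top"
    using improper_integral_right_tendsto[OF conv[unfolded laplace_converges_def]]
    unfolding laplace_def by (intro tendsto_intros)
  moreover have "\<forall>\<^sub>F R in at_top. F R - F 0 + s\<^sup>2 * integral {0..R} (\<lambda>t. ?e t * f t)
      = integral {0..R} (\<lambda>t. ?e t * f'' t)"
    using eventually_ge_at_top[of 0]
    by eventually_elim (rule integral_unique[OF int, symmetric])
  ultimately have lim: "((\<lambda>R. integral {0..R} (\<lambda>t. ?e t * f'' t))
      \<longlongrightarrow> 0 + s * 0 - F 0 + s\<^sup>2 * laplace f s) at_top"
    by (rule Lim_transform_eventually)
  show "laplace_converges f'' s"
    unfolding laplace_converges_def
    by (rule improper_integral_rightI(1)[OF _ lim]) (use int in blast)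
  have "laplace f'' s = 0 + s * 0 - F 0 + s\<^sup>2 * laplace f s"
    unfolding laplace_def[of f'']
    by (rule improper_integral_rightI(2)[OF _ lim]) (use int in blast)
  then show "laplace f'' s = s\<^sup>2 * laplace f s - s * f 0 - f' 0"
    by (simp add: F_def)
qed

text \<open>Reflection turns the kernel \<open>exp (cnj s * t)\<close> on the left half-line into
  \<open>exp (- cnj s * t)\<close> on the right one.\<close>

lemma sym_laplace_converges_eq_laplace:
  "sym_laplace_converges h s \<longleftrightarrow>
    laplace_converges h s \<and> laplace_converges (\<lambda>t. h (- t)) (cnj s)"
  by (simp add: sym_laplace_converges_def laplace_converges_def
      improper_converges_left_reflect mult.commute)

lemma sym_laplace_eq_laplace:
  "sym_laplace h s = laplace h s + laplace (\<lambda>t. h (- t)) (cnj s)"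
  by (simp add: sym_laplace_def laplace_def improper_integral_left_reflect mult.commute)

lemma has_vector_derivative_reflect:
  assumes "(f has_vector_derivative D) (at (- t))"
  shows "((\<lambda>t. f (- t)) has_vector_derivative - D) (at t)"
proof -
  have "(uminus has_vector_derivative - 1) (at t)"
    by (auto intro!: derivative_eq_intros)
  from vector_diff_chain_at[OF this assms] show ?thesis
    by (simp add: o_def)
qed

theorem theorem4:
  fixes f f' f'' :: "real \<Rightarrow> complex" and a :: real and s :: complex
  assumes "a > 0"
    and "\<And>t. (f has_vector_derivative f' t) (at t)"
    and "\<And>t. (f' has_vector_derivative f'' t) (at t)"
    and "continuous_on UNIV f" and "continuous_on UNIV f'" and "continuous_on UNIV f''"
    and "exponential_order a f" and "exponential_order a f'"
    and "Re s > a"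
  shows "laplace_converges f s \<and>
         laplace_converges (\<lambda>t. f (- t)) (cnj s) \<and>
         sym_laplace_converges f'' s \<and>
         sym_laplace f'' s =
           s\<^sup>2 * laplace f s + (cnj s)\<^sup>2 * laplace (\<lambda>t. f (- t)) (cnj s) - f 0 * (s + cnj s)"
proof -
  note right = laplace_second_derivative[OF assms(2,3,7,8,9)]
  have 1: "((\<lambda>t. f (- t)) has_vector_derivative - f' (- t)) (at t)" for t
    using assms(2) by (rule has_vector_derivative_reflect)
  \<comment> \<open>The second reflection brings a second sign, which cancels the first.\<close>
  have 2: "((\<lambda>t. - f' (- t)) has_vector_derivative f'' (- t)) (at t)" for t
    using has_vector_derivative_minus[OF has_vector_derivative_reflect[OF assms(3)]] by simp
  have s: "Re (cnj s) > a"
    using assms(9) by simp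
  note left = laplace_second_derivative[OF 1 2 exponential_order_reflect[OF assms(7)]
      exponential_order_uminus[OF exponential_order_reflect[OF assms(8)]] s]
  \<comment> \<open>The boundary terms at 0 are \<open>- s * f 0 - f' 0\<close> from the right and
    \<open>- cnj s * f 0 + f' 0\<close> from the left.\<close>
  show ?thesis
    using right(1,2) left(1,2)
    by (simp add: sym_laplace_converges_eq_laplace sym_laplace_eq_laplace right(3) left(3)
        algebra_simps)
qed

end
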